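(* Let $G$ be an infinite group (written additively, not necessarily abelian), let $S\subseteq G\setminus\{0\}$ with $S=-S$, and let $I(G)$ be the set of elements of $G$ of order $2$. If $|S\setminus I(G)|$ is either $0$ or $|G|$, then the Cayley graph $Cay[G:S]$ has a $G$-regular $1$-factorization.
   Context: $Cay[G:S]$ is the simple graph with vertex set $G$ in which $x,y$ are adjacent iff $x-y\in S$. A $1$-factor of a graph $\Lambda$ is a spanning subgraph in which every vertex has degree exactly $1$; a $1$-factorization is a set of $1$-factors whose edge sets partition $E(\Lambda)$. A $1$-factorization $\mathcal{G}$ is $G$-regular if there is an automorphism group of $\mathcal{G}$ (bijections of the vertex set mapping each member of $\mathcal{G}$ to a member of $\mathcal{G}$) isomorphic to $G$ acting sharply transitively on the vertex set. *)

theory Defs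
  imports
    "HOL-Algebra.Algebra"
    "HOL-Library.Equipollence"
    "HOL-Library.Disjoint_Sets"
begin

text \<open>Groups are those of \<open>HOL-Algebra\<close>, hence written multiplicatively: the additive
  expressions $0$, $-x$ and $x - y$ become \<open>\<one>\<close>, \<open>inv x\<close> and \<open>x \<otimes> inv y\<close>.\<close>

record 'v sgraph =
  verts :: "'v set"
  edges :: "'v set set"

definition simple_graph :: "'v sgraph \<Rightarrow> bool" where
  "simple_graph \<Lambda> \<longleftrightarrow> (\<forall>e\<in>edges \<Lambda>. e \<subseteq> verts \<Lambda> \<and> card e = 2)"

definition spanning_subgraph :: "'v sgraph \<Rightarrow> 'v sgraph \<Rightarrow> bool" where
  "spanning_subgraph F \<Lambda> \<longleftrightarrow>
     simple_graph F \<and> verts F = verts \<Lambda> \<and> edges F \<subseteq> edges \<Lambda>"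

text \<open>\<open>vdegree\<close> is meaningful only at vertices of finite degree (\<open>card\<close> of an infinite set is 0).
  It is used solely in equations \<open>vdegree F v = 1\<close>, which force finiteness.\<close>

definition vdegree :: "'v sgraph \<Rightarrow> 'v \<Rightarrow> nat" where
  "vdegree \<Lambda> v = card {e \<in> edges \<Lambda>. v \<in> e}"

definition one_factor :: "'v sgraph \<Rightarrow> 'v sgraph \<Rightarrow> bool" where
  "one_factor F \<Lambda> \<longleftrightarrow> spanning_subgraph F \<Lambda> \<and> (\<forall>v\<in>verts F. vdegree F v = 1)"

text \<open>All 1-factors of \<open>\<Lambda>\<close> have the same vertex set, so distinct ones have distinct edge sets
  and no multiplicity is lost by passing to the image \<open>edges ` \<F>\<close>.\<close>

definition one_factorization :: "'v sgraph set \<Rightarrow> 'v sgraph \<Rightarrow> bool" where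
  "one_factorization \<F> \<Lambda> \<longleftrightarrow>
     (\<forall>F\<in>\<F>. one_factor F \<Lambda>) \<and> partition_on (edges \<Lambda>) (edges ` \<F>)"

definition graph_image :: "('v \<Rightarrow> 'w) \<Rightarrow> 'v sgraph \<Rightarrow> 'w sgraph" where
  "graph_image f F = \<lparr>verts = f ` verts F, edges = (\<lambda>e. f ` e) ` edges F\<rparr>"

text \<open>An automorphism group is a group of permutations of the vertex set under composition.
  Since it is closed under inverses, each of its members permutes \<open>\<F>\<close>.\<close>

definition automorphism_group_of :: "('v \<Rightarrow> 'v) set \<Rightarrow> 'v sgraph set \<Rightarrow> 'v sgraph \<Rightarrow> bool" where
  "automorphism_group_of A \<F> \<Lambda> \<longleftrightarrow>
     subgroup A (BijGroup (verts \<Lambda>)) \<and> (\<forall>f\<in>A. \<forall>F\<in>\<F>. graph_image f F \<in> \<F>)"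

definition sharply_transitive_on :: "('v \<Rightarrow> 'v) set \<Rightarrow> 'v set \<Rightarrow> bool" where
  "sharply_transitive_on A V \<longleftrightarrow> (\<forall>x\<in>V. \<forall>y\<in>V. \<exists>!f. f \<in> A \<and> f x = y)"

definition regular_one_factorization ::
  "('a, 'b) monoid_scheme \<Rightarrow> 'v sgraph set \<Rightarrow> 'v sgraph \<Rightarrow> bool" where
  "regular_one_factorization G \<F> \<Lambda> \<longleftrightarrow>
     one_factorization \<F> \<Lambda> \<and>
     (\<exists>A. automorphism_group_of A \<F> \<Lambda> \<and>
          (BijGroup (verts \<Lambda>))\<lparr>carrier := A\<rparr> \<cong> G \<and>
          sharply_transitive_on A (verts \<Lambda>))"

definition Cay :: "('a, 'b) monoid_scheme \<Rightarrow> 'a set \<Rightarrow> 'a sgraph" where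
  "Cay G S =
     \<lparr>verts = carrier G,
      edges = {{x, y} | x y. x \<in> carrier G \<and> y \<in> carrier G \<and> x \<otimes>\<^bsub>G\<^esub> inv\<^bsub>G\<^esub> y \<in> S}\<rparr>"

definition involutions :: "('a, 'b) monoid_scheme \<Rightarrow> 'a set" where
  "involutions G = {x \<in> carrier G. group.ord G x = 2}"

lemma (in group) Cay_adjacent_iff:
  assumes S: "S \<subseteq> carrier G - {\<one>}" "S = m_inv G ` S"
    and xy: "x \<in> carrier G" "y \<in> carrier G"
  shows "{x, y} \<in> edges (Cay G S) \<longleftrightarrow> x \<otimes> inv y \<in> S"
proof
  assume "{x, y} \<in> edges (Cay G S)"
  then have "x \<otimes> inv y \<in> S \<or> y \<otimes> inv x \<in> S"
    by (auto simp: Cay_def doubleton_eq_iff)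
  moreover have "inv (y \<otimes> inv x) = x \<otimes> inv y"
    using xy by (simp add: inv_mult_group)
  ultimately show "x \<otimes> inv y \<in> S"
    using S(2) by (metis imageI)
qed (use xy in \<open>auto simp: Cay_def\<close>)

lemma (in group) simple_graph_Cay:
  assumes "S \<subseteq> carrier G - {\<one>}"
  shows "simple_graph (Cay G S)"
  using assms by (auto simp: simple_graph_def Cay_def card_2_iff) (metis Diff_iff insertI1 r_inv subsetD)

end

theory Submission
  imports Defs
begin

text \<open>Right translations preserve \<open>Cay G S\<close>. For an involution \<open>t\<close> the edges \<open>{x, t \<otimes> x}\<close> form a
  translation-invariant 1-factor. For the set \<open>T\<close> of the other labels, a 1-factor containing
  exactly one edge from each translation orbit suffices: its translates partition the edges labelled
  by \<open>T\<close>. As \<open>|T| = |G|\<close>, such a starter is built by a transfinite back-and-forth, where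
  at each stage fewer than \<open>|G|\<close> vertices and labels have been used, so the next vertex can be
  matched along a new label and the next label can be realised between new vertices.\<close>

section \<open>Cardinal bounds for sets smaller than an infinite set\<close>

text \<open>Bridge from \<open>\<prec>\<close> to the cardinal orders, in whose terms the bounds on
  unions are available.\<close>

lemma lesspoll_iff_card_of: "A \<prec> B \<longleftrightarrow> ordLess2 (card_of A) (card_of B)"
  by (metis lesspoll_def lepoll_def card_of_ordLeq eqpoll_iff_card_of_ordIso ordLeq_iff_ordLess_or_ordIso
      not_ordLess_ordIso)

lemma Un_lesspoll_infinite:
  assumes "infinite C" "A \<prec> C" "B \<prec> C"
  shows "A \<union> B \<prec> C"
  using assms card_of_Un_ordLess_infinite unfolding lesspoll_iff_card_of by blast

text \<open>For infinite \<open>I\<close> every block is smaller than \<open>I\<close>, so the whole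
  union has size at most |I|. This bound stays below |K| even when |K| is singular.\<close>

lemma UN_finite_lesspoll_infinite:
  assumes K: "infinite K" and I: "I \<prec> K" and fin: "\<And>i. i \<in> I \<Longrightarrow> finite (A i)"
  shows "(\<Union>i\<in>I. A i) \<prec> K"
proof (cases "finite I")
  case True
  then show ?thesis using K fin by (simp add: finite_lesspoll_infinite)
next
  case False
  have "\<forall>i\<in>I. ordLeq3 (card_of (A i)) (card_of I)"
    using False fin finite_lesspoll_infinite lesspoll_iff_card_of ordLess_imp_ordLeq by blast
  then have "ordLeq3 (card_of (\<Union>i\<in>I. A i)) (card_of I)"
    by (intro card_of_UNION_ordLeq_infinite) (use False in auto)
  then show ?thesis
    using I unfolding lesspoll_iff_card_of by (rule ordLeq_ordLess_trans)
qed

text \<open>Used to count bad candidates: those whose image under an injective map falls into the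
  part \<open>A\<close> already used.\<close>

lemma vimage_inj_lesspoll:
  assumes "inj_on f D" "A \<prec> K"
  shows "{x \<in> D. f x \<in> A} \<prec> K"
proof -
  have "{x \<in> D. f x \<in> A} \<lesssim> A"
    using assms(1) unfolding lepoll_def by (intro exI[of _ f]) (auto simp: inj_on_def)
  then show ?thesis using assms(2) lesspoll_trans1 by blast
qed

section \<open>Transfinite greedy partition into finite blocks\<close>

text \<open>Greedy recursion along a well-order of \<open>K\<close> of minimal length: since the blocks are finite,
  fewer than \<open>|K|\<close> points are covered before each stage.\<close>

lemma partition_on_by_finite_blocks:
  fixes K :: "'k set"
  assumes K: "infinite K"
    and blocks: "\<And>h. h \<in> H \<Longrightarrow> finite h \<and> h \<subseteq> K"
    and avoid: "\<And>k \<A>. \<lbrakk>k \<in> K; \<A> \<subseteq> H; k \<notin> \<Union>\<A>; \<Union>\<A> \<prec> K\<rbrakk>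
      \<Longrightarrow> \<exists>h\<in>H. k \<in> h \<and> h \<inter> \<Union>\<A> = {}"
  shows "\<exists>P\<subseteq>H. partition_on K P"
proof -
  \<comment> \<open>A cardinal well-order: every proper initial segment is strictly smaller than
    \<open>K\<close>.\<close>
  define r where "r = card_of K"
  have wo: "Well_order r" and Field: "Field r = K"
    by (simp_all add: r_def)
  then have wf: "wf (r - Id)" by (simp add: well_order_on_def)
  define U where "U f k = \<Union>(f ` underS r k)" for f :: "'k \<Rightarrow> 'k set" and k
  \<comment> \<open>The empty set is the default at points that an earlier block already covers;
    these values are discarded in \<open>P\<close>.\<close>
  define pick where
    "pick f k = (if k \<in> U f k then {} else SOME h. h \<in> H \<and> k \<in> h \<and> h \<inter> U f k = {})" for f k
  define f where "f = wfrec (r - Id) pick"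
  \<comment> \<open>\<open>pick\<close> consults \<open>f\<close> only on \<open>underS r k\<close>,
    exactly where \<open>cut\<close> keeps its values, so \<open>cut\<close> disappears from the
    recursion equation.\<close>
  have "pick (cut f (r - Id) k) k = pick f k" for k
  proof -
    have "cut f (r - Id) k ` underS r k = f ` underS r k"
      by (intro image_cong refl cut_apply) (auto simp: underS_def)
    then show ?thesis unfolding pick_def U_def by simp
  qed
  then have f_eq: "f k = pick f k" for k
    unfolding f_def by (subst wfrec[OF wf]) (simp add: f_def)
  have stage: "k \<in> U f k \<and> f k = {} \<or> f k \<in> H \<and> k \<in> f k \<and> f k \<inter> U f k = {}"
    if "k \<in> K" for k
    using that
  proof (induction k rule: wf_induct_rule[OF wf])
    case (1 k)
    have prev: "f j = {} \<or> f j \<in> H" if "j \<in> underS r k" for j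
    proof -
      have "j \<in> K" "(j, k) \<in> r - Id"
        using that Field by (auto simp: underS_def Field_def)
      from 1(1)[OF this(2,1)] show ?thesis by blast
    qed
    then have fin: "finite (f j)" if "j \<in> underS r k" for j
      using that blocks by (metis finite.emptyI)
    \<comment> \<open>Dropping the default value puts the earlier choices inside \<open>H\<close>,
      as \<open>avoid\<close> demands, and leaves their union unchanged.\<close>
    define \<A> where "\<A> = f ` underS r k - {{}}"
    have "\<A> \<subseteq> H" "\<Union>\<A> = U f k"
      using prev by (auto simp: \<A>_def U_def)
    have "underS r k \<prec> K"
      using card_of_underS[of r k] 1(2) Field
      by (simp add: lesspoll_iff_card_of r_def card_of_Card_order)
    then have "U f k \<prec> K"
      unfolding U_def by (rule UN_finite_lesspoll_infinite[OF K _ fin])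
    then have "k \<notin> U f k \<Longrightarrow> \<exists>h. h \<in> H \<and> k \<in> h \<and> h \<inter> U f k = {}"
      using avoid[OF 1(2) \<open>\<A> \<subseteq> H\<close>] unfolding \<open>\<Union>\<A> = U f k\<close> by blast
    then show ?case
      using someI_ex[of "\<lambda>h. h \<in> H \<and> k \<in> h \<and> h \<inter> U f k = {}"] f_eq[of k]
      by (cases "k \<in> U f k") (auto simp: pick_def)
  qed
  define P where "P = f ` K - {{}}"
  have "P \<subseteq> H"
    using stage unfolding P_def by blast
  moreover have "partition_on K P"
  proof (rule partition_onI)
    have "k \<in> \<Union>P" if k: "k \<in> K" for k
    proof (cases "k \<in> U f k")
      case True
      then obtain j where "j \<in> underS r k" "k \<in> f j" by (auto simp: U_def)
      moreover from this have "j \<in> K" using Field by (auto simp: underS_def Field_def)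
      ultimately show ?thesis by (auto simp: P_def)
    next
      case False
      then show ?thesis using stage[OF k] k by (auto simp: P_def)
    qed
    then show "\<Union>P = K" using \<open>P \<subseteq> H\<close> blocks by blast
    \<comment> \<open>Either \<open>f j\<close> is empty, or it was chosen disjoint from
      \<open>U f j\<close>, which contains \<open>f i\<close>.\<close>
    have earlier: "disjnt (f i) (f j)" if "i \<in> underS r j" "j \<in> K" for i j
      using stage[OF that(2)] that(1) by (auto simp: U_def disjnt_def)
    show "disjnt p q" if pq: "p \<in> P" "q \<in> P" "p \<noteq> q" for p q
    proof -
      obtain i j where ij: "i \<in> K" "j \<in> K" "p = f i" "q = f j" "i \<noteq> j"
        using pq by (auto simp: P_def)
      then have "(i, j) \<in> r \<or> (j, i) \<in> r"
        using wo Field by (metis well_order_on_def linear_order_on_def total_on_def)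
      then show ?thesis
        using ij earlier by (auto simp: underS_def intro: disjnt_sym)
    qed
  qed (simp add: P_def)
  ultimately show ?thesis by blast
qed

section \<open>Involutions, edge labels and translates of edges\<close>

lemma (in group) involutions_iff:
  assumes "x \<in> carrier G"
  shows "x \<in> involutions G \<longleftrightarrow> x \<noteq> \<one> \<and> x \<otimes> x = \<one>"
proof -
  have "x \<otimes> x = \<one> \<longleftrightarrow> ord x dvd 2"
    using pow_eq_id[OF assms, of 2] assms by (simp add: numeral_2_eq_2)
  moreover have "ord x dvd 2 \<longleftrightarrow> ord x = 1 \<or> ord x = 2"
    by (metis two_is_prime_nat prime_nat_iff dvd_refl one_dvd)
  ultimately show ?thesis
    using ord_eq_1[OF assms] assms by (auto simp: involutions_def)
qed

text \<open>Describes an edge by a start vertex \<open>x\<close> and a label \<open>s\<close>. Since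
  labels multiply on the left, right translations move \<open>x\<close> and keep
  \<open>s\<close>.\<close>

lemma (in group) edges_Cay:
  assumes "S \<subseteq> carrier G"
  shows "edges (Cay G S) = {{x, s \<otimes> x} | x s. x \<in> carrier G \<and> s \<in> S}"
proof (intro equalityI subsetI)
  fix e assume "e \<in> edges (Cay G S)"
  then obtain x y where "e = {x, y}" "x \<in> carrier G" "y \<in> carrier G" "x \<otimes> inv y \<in> S"
    by (auto simp: Cay_def)
  moreover from this have "e = {y, x \<otimes> inv y \<otimes> y}"
    by (simp add: m_assoc insert_commute)
  ultimately show "e \<in> {{x, s \<otimes> x} | x s. x \<in> carrier G \<and> s \<in> S}" by blast
next
  fix e assume "e \<in> {{x, s \<otimes> x} | x s. x \<in> carrier G \<and> s \<in> S}"
  then obtain x s where "e = {x, s \<otimes> x}" "x \<in> carrier G" "s \<in> S" by blast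
  moreover from this have "s \<in> carrier G" using assms by blast
  ultimately have "e = {s \<otimes> x, x}" "s \<otimes> x \<in> carrier G" "x \<in> carrier G" "s \<otimes> x \<otimes> inv x \<in> S"
    by (auto simp: m_assoc)
  then show "e \<in> edges (Cay G S)" unfolding Cay_def by auto
qed

text \<open>An edge can be read only from its two ends, and reading it from the other end inverts
  the label.\<close>

lemma (in group) edge_label_unique:
  assumes "x \<in> carrier G" "y \<in> carrier G" "s \<in> carrier G" "t \<in> carrier G"
    and "{x, s \<otimes> x} = {y, t \<otimes> y}"
  shows "t = s \<or> t = inv s"
proof (cases "x = y")
  case True
  then show ?thesis using assms by (auto simp: doubleton_eq_iff)
next
  case False
  then have "x = t \<otimes> y" "y = s \<otimes> x" using assms(5) by (auto simp: doubleton_eq_iff)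
  then have "t \<otimes> s \<otimes> x = \<one> \<otimes> x" using assms by (simp add: m_assoc)
  then have "t \<otimes> s = \<one>" using assms by (metis m_closed one_closed r_cancel)
  then show ?thesis using assms inv_equality by metis
qed

lemma (in group) edge_translate:
  assumes "x \<in> carrier G" "a \<in> carrier G" "s \<in> carrier G"
  shows "{x, s \<otimes> x} #> a = {x \<otimes> a, s \<otimes> (x \<otimes> a)}"
  using assms by (auto simp: r_coset_def m_assoc)

text \<open>Distinct translates of the start vertex could give the same edge only by exchanging its
  ends, which forces \<open>s \<otimes> s = \<one>\<close>. Hence translations act freely on edges
  with other labels.\<close>

lemma (in group) edge_translate_eq_imp:
  assumes "x \<in> carrier G" "a \<in> carrier G" "b \<in> carrier G" "s \<in> carrier G" "s \<otimes> s \<noteq> \<one>"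
    and "{x \<otimes> a, s \<otimes> (x \<otimes> a)} = {x \<otimes> b, s \<otimes> (x \<otimes> b)}"
  shows "a = b"
proof (rule ccontr)
  assume "a \<noteq> b"
  then have "x \<otimes> a \<noteq> x \<otimes> b" using assms by simp
  then have "x \<otimes> a = s \<otimes> (x \<otimes> b)" "s \<otimes> (x \<otimes> a) = x \<otimes> b"
    using assms(6) by (auto simp: doubleton_eq_iff)
  then have "s \<otimes> s \<otimes> (x \<otimes> a) = \<one> \<otimes> (x \<otimes> a)" using assms by (simp add: m_assoc)
  then show False using assms by (metis m_closed one_closed r_cancel)
qed

section \<open>Translation-invariant factorizations as families of edge sets\<close>

text \<open>A 1-factor is represented by its edge set alone; as its members are edges, partitioning
  \<open>carrier G\<close> means having degree 1 everywhere. The coset \<open>e #> a\<close> serves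
  as the right translate of \<open>e\<close>.\<close>

definition translation_factorization ::
  "('a, 'b) monoid_scheme \<Rightarrow> 'a set \<Rightarrow> 'a set set set \<Rightarrow> bool" where
  "translation_factorization G S \<E> \<longleftrightarrow>
     partition_on (edges (Cay G S)) \<E> \<and>
     (\<forall>E\<in>\<E>. partition_on (carrier G) E \<and> (\<forall>a\<in>carrier G. (\<lambda>e. e #>\<^bsub>G\<^esub> a) ` E \<in> \<E>))"

lemma (in group) translation_factorization_empty: "translation_factorization G {} {}"
  by (simp add: translation_factorization_def Cay_def partition_on_empty)

lemma (in group) translation_factorization_Un:
  assumes "translation_factorization G S \<E>" "translation_factorization G T \<F>"
    and "edges (Cay G S) \<inter> edges (Cay G T) = {}"
  shows "translation_factorization G (S \<union> T) (\<E> \<union> \<F>)"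
proof -
  have "edges (Cay G (S \<union> T)) = edges (Cay G S) \<union> edges (Cay G T)"
    by (auto simp: Cay_def)
  moreover have \<E>: "partition_on (edges (Cay G S)) \<E>" and \<F>: "partition_on (edges (Cay G T)) \<F>"
    using assms by (simp_all add: translation_factorization_def)
  moreover have "disjoint (\<E> \<union> \<F>)"
    using partition_onD2[OF \<E>] partition_onD2[OF \<F>] partition_onD1[OF \<E>] partition_onD1[OF \<F>] assms(3)
    by (intro disjoint_union) simp_all
  ultimately have "partition_on (edges (Cay G (S \<union> T))) (\<E> \<union> \<F>)"
    by (simp add: partition_on_def)
  then show ?thesis
    using assms by (auto simp: translation_factorization_def)
qed

text \<open>Left multiplication by an involution \<open>t\<close> is its own inverse and commutes
  with right translations, so its orbits form a 1-factor fixed by all of them. As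
  \<open>inv t = t\<close>, different involutions label different edges.\<close>

lemma (in group) translation_factorization_involutions:
  assumes "S \<subseteq> involutions G"
  shows "translation_factorization G S ((\<lambda>t. {{x, t \<otimes> x} | x. x \<in> carrier G}) ` S)"
proof -
  have S: "s \<in> carrier G" "s \<otimes> s = \<one>" "inv s = s" if "s \<in> S" for s
  proof -
    have s: "s \<in> involutions G" using that assms by blast
    then show "s \<in> carrier G" by (simp add: involutions_def)
    then show "s \<otimes> s = \<one>" using s by (simp add: involutions_iff)
    then show "inv s = s" using \<open>s \<in> carrier G\<close> by (simp add: inv_equality)
  qed
  have SG: "S \<subseteq> carrier G" using S(1) by blast
  define M where "M t = {{x, t \<otimes> x} | x. x \<in> carrier G}" for t
  have "partition_on (edges (Cay G S)) (M ` S)"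
  proof (rule partition_onI)
    show "\<Union> (M ` S) = edges (Cay G S)"
      unfolding edges_Cay[OF SG] M_def by blast
    show "disjnt p q" if pq: "p \<in> M ` S" "q \<in> M ` S" "p \<noteq> q" for p q
    proof -
      from pq obtain s t where st: "s \<in> S" "t \<in> S" "p = M s" "q = M t" "s \<noteq> t" by blast
      have False if e: "e \<in> M s" "e \<in> M t" for e
      proof -
        obtain x y where "x \<in> carrier G" "y \<in> carrier G" "{x, s \<otimes> x} = {y, t \<otimes> y}"
          using e by (auto simp: M_def)
        then show False
          using edge_label_unique[of x y s t] S(1,3) st(1,2,5) by metis
      qed
      then show ?thesis using st by (auto simp: disjnt_def)
    qed
    show "{} \<notin> M ` S" by (auto simp: M_def)
  qed
  moreover have "partition_on (carrier G) (M t)" if t: "t \<in> S" for t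
  proof (rule partition_onI)
    show "\<Union> (M t) = carrier G" using S[OF t] by (auto simp: M_def)
    show "disjnt p q" if pq: "p \<in> M t" "q \<in> M t" "p \<noteq> q" for p q
    proof -
      \<comment> \<open>Either end determines the edge, so two edges with a common vertex
        coincide.\<close>
      have "p = {z, t \<otimes> z}" if "p \<in> M t" "z \<in> p" for p z
      proof -
        obtain x where x: "x \<in> carrier G" "p = {x, t \<otimes> x}"
          using \<open>p \<in> M t\<close> by (auto simp: M_def)
        then have "t \<otimes> (t \<otimes> x) = x"
          using S(1,2)[OF t] by (simp add: m_assoc[symmetric])
        then show ?thesis using x \<open>z \<in> p\<close> by auto
      qed
      then show ?thesis using pq by (metis disjnt_iff)
    qed
    show "{} \<notin> M t" by (auto simp: M_def)
  qed
  moreover have "(\<lambda>e. e #> a) ` M t = M t" if t: "t \<in> S" and a: "a \<in> carrier G" for t a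
  proof (intro equalityI subsetI)
    fix e assume "e \<in> (\<lambda>e. e #> a) ` M t"
    then obtain x where "x \<in> carrier G" "e = {x, t \<otimes> x} #> a" by (auto simp: M_def)
    then show "e \<in> M t"
      using edge_translate a S[OF t] by (auto simp: M_def)
  next
    fix e assume "e \<in> M t"
    then obtain x where x: "x \<in> carrier G" "e = {x, t \<otimes> x}" by (auto simp: M_def)
    then have "e = {x \<otimes> inv a, t \<otimes> (x \<otimes> inv a)} #> a"
      using edge_translate[of "x \<otimes> inv a" a t] a S[OF t] by (simp add: m_assoc)
    then show "e \<in> (\<lambda>e. e #> a) ` M t" using x a by (auto simp: M_def)
  qed
  ultimately show ?thesis
    unfolding translation_factorization_def M_def[symmetric] by auto
qed

section \<open>Construction of the starter\<close>

text \<open>Points of \<open>carrier G <+> T\<close> are vertices to be matched and labels to be used; the block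
  below is the edge \<open>{x, s \<otimes> x}\<close> together with its two labels.\<close>

lemma (in group) exists_starter:
  assumes inf: "infinite (carrier G)" and T: "T \<subseteq> carrier G" "\<And>s. s \<in> T \<Longrightarrow> inv s \<in> T"
    and eq: "T \<approx> carrier G"
  obtains M where "partition_on (carrier G) M"
    and "\<And>e. e \<in> M \<Longrightarrow> \<exists>x\<in>carrier G. \<exists>s\<in>T. e = {x, s \<otimes> x}"
    and "\<And>s. s \<in> T \<Longrightarrow> \<exists>!e. e \<in> M \<and> (\<exists>x\<in>carrier G. e = {x, s \<otimes> x})"
proof -
  \<comment> \<open>Both \<open>s\<close> and \<open>inv s\<close> label this edge, so one block
    uses them up together and neither can recur on another edge.\<close>
  define B where "B x s = {Inl x, Inl (s \<otimes> x), Inr s, Inr (inv s)}" for x s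
  define K where "K = carrier G <+> T"
  define H where "H = {B x s | x s. x \<in> carrier G \<and> s \<in> T}"
  have infT: "infinite T" using inf eq eqpoll_finite_iff by blast
  have infK: "infinite K" using inf by (simp add: K_def)
  \<comment> \<open>Here |T| = |G| enters: \<open>K\<close>, \<open>T\<close> and
    \<open>carrier G\<close> have one size, so a used part smaller than \<open>K\<close> exhausts
    neither labels nor vertices.\<close>
  have "ordIso2 (card_of K) (card_of (carrier G))"
    unfolding K_def using inf eq
    by (intro card_of_Plus_infinite1) (auto simp: eqpoll_iff_card_of_ordIso ordIso_iff_ordLeq)
  then have KG: "K \<approx> carrier G" by (simp add: eqpoll_iff_card_of_ordIso)
  then have KT: "K \<approx> T" using eq eqpoll_sym eqpoll_trans by blast
  have H: "finite h \<and> h \<subseteq> K" if "h \<in> H" for h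
    using that T by (auto simp: H_def K_def B_def)
  have avoid: "\<exists>h\<in>H. k \<in> h \<and> h \<inter> \<Union>\<A> = {}"
    if k: "k \<in> K" "k \<notin> \<Union>\<A>" and \<A>: "\<A> \<subseteq> H" "\<Union>\<A> \<prec> K" for k \<A>
  proof -
    define A where "A = \<Union>\<A>"
    note k = k[folded A_def] and A = \<A>(2)[folded A_def]
    \<comment> \<open>Used labels are closed under inversion because every block is; hence the
      inverse of a fresh label is fresh too.\<close>
    have inv_A: "Inr s \<in> A" if "Inr (inv s) \<in> A" "s \<in> carrier G" for s
    proof -
      obtain x t where xt: "t \<in> T" "B x t \<in> \<A>" "Inr (inv s) \<in> B x t"
        using \<open>Inr (inv s) \<in> A\<close> \<A>(1) by (auto simp: A_def H_def)
      then have "t \<in> carrier G" "inv s = t \<or> inv s = inv t"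
        using T(1) by (auto simp: B_def)
      then have "s = t \<or> s = inv t" using \<open>s \<in> carrier G\<close> by (metis inv_inv)
      then have "Inr s \<in> B x t" by (auto simp: B_def)
      then show ?thesis using xt(2) unfolding A_def by blast
    qed
    have "A \<prec> carrier G" "A \<prec> T" using A KG KT lesspoll_eq_trans by blast+
    show ?thesis
    proof (cases k)
      case (Inl g)
      then have g: "g \<in> carrier G" using k by (auto simp: K_def)
      \<comment> \<open>Matching the vertex \<open>g\<close>: a label is bad if it, its inverse or
        the far end \<open>s \<otimes> g\<close> is used. Each condition excludes fewer than |T|
        labels.\<close>
      have "inj_on Inr T" "inj_on (\<lambda>s. Inl (s \<otimes> g)) T"
        using T(1) g by (auto simp: inj_on_def subset_iff)
      moreover have "inj_on (\<lambda>s. Inr (inv s)) T"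
        using T(1) by (intro inj_onI) (metis inv_inv subsetD sum.inject(2))
      ultimately have "{s \<in> T. Inr s \<in> A} \<union> {s \<in> T. Inr (inv s) \<in> A} \<union> {s \<in> T. Inl (s \<otimes> g) \<in> A} \<prec> T"
        using \<open>A \<prec> T\<close> by (intro Un_lesspoll_infinite[OF infT] vimage_inj_lesspoll)
      then obtain s where "s \<in> T" "Inr s \<notin> A" "Inr (inv s) \<notin> A" "Inl (s \<otimes> g) \<notin> A"
        by (smt (verit, best) UnI1 UnI2 lesspoll_def mem_Collect_eq subsetI subset_imp_lepoll lepoll_antisym)
      then show ?thesis
        using Inl k g by (intro bexI[of _ "B g s"]) (auto simp: B_def H_def A_def)
    next
      case (Inr s)
      then have s: "s \<in> T" "s \<in> carrier G" using k T(1) by (auto simp: K_def)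
      \<comment> \<open>Realising the label \<open>s\<close>: a start vertex is bad if either end of
        its edge is used, which excludes fewer than |G| vertices.\<close>
      have "inj_on Inl (carrier G)" "inj_on (\<lambda>x. Inl (s \<otimes> x)) (carrier G)"
        using s by (auto simp: inj_on_def)
      then have "{x \<in> carrier G. Inl x \<in> A} \<union> {x \<in> carrier G. Inl (s \<otimes> x) \<in> A} \<prec> carrier G"
        using \<open>A \<prec> carrier G\<close> by (intro Un_lesspoll_infinite[OF inf] vimage_inj_lesspoll)
      then obtain x where "x \<in> carrier G" "Inl x \<notin> A" "Inl (s \<otimes> x) \<notin> A"
        by (smt (verit, best) UnI1 UnI2 lesspoll_def mem_Collect_eq subsetI subset_imp_lepoll lepoll_antisym)
      moreover have "Inr (inv s) \<notin> A" using inv_A k Inr s by blast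
      ultimately show ?thesis
        using Inr k s by (intro bexI[of _ "B x s"]) (auto simp: B_def H_def A_def)
    qed
  qed
  obtain P where P: "P \<subseteq> H" "partition_on K P"
    using partition_on_by_finite_blocks[OF infK H avoid] by blast
  \<comment> \<open>Forgetting the labels turns each block into its edge, and the partition of
    \<open>K\<close> into one of \<open>carrier G\<close>.\<close>
  define M where "M = (\<lambda>p. Inl -` p) ` P"
  have vimage_B: "Inl -` B x s = {x, s \<otimes> x}" for x s by (auto simp: B_def)
  have PB: "\<exists>x\<in>carrier G. \<exists>s\<in>T. p = B x s" if "p \<in> P" for p
    using that P(1) unfolding H_def by blast
  have "partition_on (Inl -` K) (M - {{}})"
    using partition_on_vimage[OF P(2)] unfolding M_def .
  moreover have "{} \<notin> M" using PB vimage_B by (fastforce simp: M_def)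
  moreover have "Inl -` K = carrier G" by (auto simp: K_def)
  ultimately have part: "partition_on (carrier G) M" by simp
  have edge: "\<exists>x\<in>carrier G. \<exists>s\<in>T. e = {x, s \<otimes> x}" if "e \<in> M" for e
    using that PB vimage_B unfolding M_def by blast
  have label: "\<exists>!e. e \<in> M \<and> (\<exists>x\<in>carrier G. e = {x, s \<otimes> x})" if s: "s \<in> T" for s
  proof (rule ex_ex1I)
    have "Inr s \<in> \<Union>P" using s partition_onD1[OF P(2)] by (auto simp: K_def)
    then obtain x t where xt: "x \<in> carrier G" "t \<in> T" "B x t \<in> P" "Inr s \<in> B x t"
      using PB by blast
    have M: "{x, t \<otimes> x} \<in> M"
      unfolding M_def vimage_B[symmetric] using xt(3) by (rule imageI)
    have tG: "t \<in> carrier G" using xt T by blast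
    have "s = t \<or> s = inv t" using xt(4) by (auto simp: B_def)
    then show "\<exists>e. e \<in> M \<and> (\<exists>x\<in>carrier G. e = {x, s \<otimes> x})"
    proof
      assume "s = t"
      then show ?thesis using M xt by blast
    next
      assume "s = inv t"
      \<comment> \<open>The edge is read from its other end \<open>t \<otimes> x\<close>, where its
        label is \<open>inv t\<close>.\<close>
      then have "s \<otimes> (t \<otimes> x) = x" using xt tG by (simp add: m_assoc[symmetric])
      then have "{x, t \<otimes> x} = {t \<otimes> x, s \<otimes> (t \<otimes> x)}" by auto
      then show ?thesis using M xt tG m_closed by blast
    qed
  next
    fix e e'
    have sG: "s \<in> carrier G" using s T by blast
    \<comment> \<open>An edge labelled \<open>s\<close> comes from a block with label
      \<open>s\<close> or \<open>inv s\<close>, which contains \<open>Inr s\<close> either way;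
      disjointness of \<open>P\<close> leaves only one such block.\<close>
    have *: "\<exists>p\<in>P. Inr s \<in> p \<and> d = Inl -` p"
      if d: "d \<in> M \<and> (\<exists>x\<in>carrier G. d = {x, s \<otimes> x})" for d
    proof -
      from d obtain p y where p: "p \<in> P" "d = Inl -` p" "y \<in> carrier G" "d = {y, s \<otimes> y}"
        by (auto simp: M_def)
      obtain x t where xt: "x \<in> carrier G" "t \<in> T" "p = B x t" using PB p by blast
      have "s = t \<or> s = inv t"
        using edge_label_unique[of x y t s] xt p sG T(1) vimage_B by auto
      then have "Inr s \<in> p" unfolding xt(3) by (auto simp: B_def)
      then show ?thesis using p(1,2) by blast
    qed
    assume "e \<in> M \<and> (\<exists>x\<in>carrier G. e = {x, s \<otimes> x})" "e' \<in> M \<and> (\<exists>x\<in>carrier G. e' = {x, s \<otimes> x})"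
    then obtain p p' where "p \<in> P" "Inr s \<in> p" "e = Inl -` p" "p' \<in> P" "Inr s \<in> p'" "e' = Inl -` p'"
      using *[of e] *[of e'] by blast
    moreover from this have "p = p'"
      using partition_onD2[OF P(2)] by (auto simp: pairwise_def disjnt_def)
    ultimately show "e = e'" by simp
  qed
  show thesis using that[OF part edge label] .
qed

section \<open>Translates of a starter\<close>

lemma (in group) partition_on_translate:
  assumes M: "partition_on (carrier G) M" and a: "a \<in> carrier G"
  shows "partition_on (carrier G) ((\<lambda>e. e #> a) ` M)"
proof -
  have coset: "e #> a = (\<lambda>x. x \<otimes> a) ` e" for e by (auto simp: r_coset_def)
  have "(\<lambda>x. x \<otimes> a) ` carrier G = carrier G"
    using a surj_const_mult by (metis coset coset_join2 subgroup_self)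
  moreover have "inj_on (\<lambda>x. x \<otimes> a) (carrier G)"
    using a by (auto simp: inj_on_def)
  moreover have "{} \<notin> (\<lambda>e. e #> a) ` M"
    using partition_onD3[OF M] by (auto simp: coset)
  ultimately show ?thesis
    using partition_on_inj_image[OF M, of "\<lambda>x. x \<otimes> a"] by (simp add: coset)
qed

text \<open>An edge labelled \<open>s\<close> is a translate of the one edge of \<open>M\<close>
  with that label, so the translates of \<open>M\<close> cover. They are disjoint because
  translations act freely on edges with noninvolutory labels.\<close>

lemma (in group) translation_factorization_starter:
  assumes T: "T \<subseteq> carrier G" and noninv: "\<And>s. s \<in> T \<Longrightarrow> s \<otimes> s \<noteq> \<one>"
    and M: "partition_on (carrier G) M"
    and edge: "\<And>e. e \<in> M \<Longrightarrow> \<exists>x\<in>carrier G. \<exists>s\<in>T. e = {x, s \<otimes> x}"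
    and label: "\<And>s. s \<in> T \<Longrightarrow> \<exists>!e. e \<in> M \<and> (\<exists>x\<in>carrier G. e = {x, s \<otimes> x})"
  shows "translation_factorization G T ((\<lambda>a. (\<lambda>e. e #> a) ` M) ` carrier G)"
proof -
  define N where "N a = (\<lambda>e. e #> a) ` M" for a
  have MG: "e \<subseteq> carrier G" if "e \<in> M" for e using partition_onD1[OF M] that by blast
  have N_mult: "(\<lambda>e. e #> b) ` N a = N (a \<otimes> b)" if "a \<in> carrier G" "b \<in> carrier G" for a b
    unfolding N_def image_image by (intro image_cong refl coset_mult_assoc MG that)
  have N_edge: "\<exists>x\<in>carrier G. \<exists>s\<in>T. e = {x \<otimes> a, s \<otimes> (x \<otimes> a)}"
    if "e \<in> N a" "a \<in> carrier G" for e a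
  proof -
    obtain d where d: "d \<in> M" "e = d #> a" using \<open>e \<in> N a\<close> by (auto simp: N_def)
    obtain x s where xs: "x \<in> carrier G" "s \<in> T" "d = {x, s \<otimes> x}" using edge[OF d(1)] by blast
    then have "e = {x \<otimes> a, s \<otimes> (x \<otimes> a)}"
      using edge_translate[of x a s] d(2) T \<open>a \<in> carrier G\<close> by auto
    then show ?thesis using xs by blast
  qed
  have unique: "a = b" if e: "e \<in> N a" "e \<in> N b" and ab: "a \<in> carrier G" "b \<in> carrier G" for e a b
  proof -
    obtain x s where xs: "x \<in> carrier G" "s \<in> T" "e = {x, s \<otimes> x}"
      using N_edge[OF e(1) ab(1)] ab by blast
    then have s: "s \<in> carrier G" using T by blast
    \<comment> \<open>Translating \<open>e\<close> back keeps its label and lands in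
      \<open>M\<close>. For \<open>c = a\<close> and \<open>c = b\<close> the result is thus the
      same edge, and freeness yields \<open>a = b\<close>.\<close>
    have shift_M: "{x \<otimes> inv c, s \<otimes> (x \<otimes> inv c)} \<in> M" if "e \<in> N c" "c \<in> carrier G" for c
    proof -
      from that obtain d where d: "d \<in> M" "e = d #> c" by (auto simp: N_def)
      then have "e #> inv c = d" using MG that(2) by (simp add: coset_mult_assoc)
      then show ?thesis using d(1) xs s that(2) by (simp add: edge_translate)
    qed
    have "{x \<otimes> inv a, s \<otimes> (x \<otimes> inv a)} = {x \<otimes> inv b, s \<otimes> (x \<otimes> inv b)}"
      using label[OF xs(2)] shift_M[OF e(1) ab(1)] shift_M[OF e(2) ab(2)] xs(1) ab by blast
    then have "inv a = inv b"
      using edge_translate_eq_imp[of x "inv a" "inv b" s] xs s ab noninv by blast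
    then show ?thesis using ab by (metis inv_inv)
  qed
  have "partition_on (edges (Cay G T)) (N ` carrier G)"
  proof (rule partition_onI)
    show "\<Union> (N ` carrier G) = edges (Cay G T)"
    proof (intro equalityI subsetI)
      fix e assume "e \<in> \<Union> (N ` carrier G)"
      then show "e \<in> edges (Cay G T)"
        using N_edge by (fastforce simp: edges_Cay[OF T])
    next
      fix e assume "e \<in> edges (Cay G T)"
      then obtain x s where xs: "x \<in> carrier G" "s \<in> T" "e = {x, s \<otimes> x}"
        by (auto simp: edges_Cay[OF T])
      then have s: "s \<in> carrier G" using T by blast
      obtain y where y: "y \<in> carrier G" "{y, s \<otimes> y} \<in> M" using label[OF xs(2)] by blast
      \<comment> \<open>Right multiplication by \<open>inv y \<otimes> x\<close> carries
        \<open>y\<close> to \<open>x\<close>.\<close>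
      have "e = {y, s \<otimes> y} #> (inv y \<otimes> x)"
        using xs y s by (simp add: edge_translate m_assoc[symmetric])
      then have "e \<in> N (inv y \<otimes> x)" using y by (auto simp: N_def)
      moreover have "inv y \<otimes> x \<in> carrier G" using xs y by simp
      ultimately show "e \<in> \<Union> (N ` carrier G)" by blast
    qed
    show "disjnt p q" if "p \<in> N ` carrier G" "q \<in> N ` carrier G" "p \<noteq> q" for p q
      using that unique by (auto simp: disjnt_def)
    have "M \<noteq> {}" using partition_onD1[OF M] by auto
    then show "{} \<notin> N ` carrier G" by (auto simp: N_def)
  qed
  moreover have "partition_on (carrier G) (N a)" if "a \<in> carrier G" for a
    unfolding N_def by (rule partition_on_translate[OF M that])
  ultimately show ?thesis
    unfolding translation_factorization_def N_def[symmetric] using N_mult by auto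
qed

section \<open>The right regular representation of the group\<close>

text \<open>The inverse makes this a homomorphism rather than an antihomomorphism.\<close>

definition right_translation :: "('a, 'b) monoid_scheme \<Rightarrow> 'a \<Rightarrow> 'a \<Rightarrow> 'a" where
  "right_translation G g = (\<lambda>x\<in>carrier G. x \<otimes>\<^bsub>G\<^esub> inv\<^bsub>G\<^esub> g)"

lemma (in group) right_translation_Bij:
  assumes "g \<in> carrier G"
  shows "right_translation G g \<in> Bij (carrier G)"
proof -
  have "bij_betw (\<lambda>x. x \<otimes> inv g) (carrier G) (carrier G)"
    using assms by (intro bij_betw_byWitness[where f' = "\<lambda>x. x \<otimes> g"]) (auto simp: m_assoc)
  then show ?thesis
    unfolding Bij_def right_translation_def by (auto cong: bij_betw_cong)
qed

lemma (in group) right_translation_hom: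
  "right_translation G \<in> hom G (BijGroup (carrier G))"
proof (rule homI)
  show "right_translation G x \<in> carrier (BijGroup (carrier G))" if "x \<in> carrier G" for x
    using that right_translation_Bij by (simp add: BijGroup_def)
  show "right_translation G (x \<otimes> y) =
      right_translation G x \<otimes>\<^bsub>BijGroup (carrier G)\<^esub> right_translation G y"
    if "x \<in> carrier G" "y \<in> carrier G" for x y
    using that right_translation_Bij[of x] right_translation_Bij[of y]
    by (auto simp: BijGroup_def compose_def right_translation_def inv_mult_group m_assoc)
qed

lemma (in group) right_translation_inj: "inj_on (right_translation G) (carrier G)"
proof (rule inj_onI)
  fix x y assume xy: "x \<in> carrier G" "y \<in> carrier G" "right_translation G x = right_translation G y"
  then have "right_translation G x \<one> = right_translation G y \<one>" by simp
  then show "x = y" using xy(1,2) by (simp add: right_translation_def) (metis inv_inv)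
qed

lemma (in group) right_translations_subgroup:
  "subgroup (right_translation G ` carrier G) (BijGroup (carrier G))"
  using right_translation_hom group_BijGroup is_group
  by (intro group_hom.img_is_subgroup) (simp add: group_hom_def group_hom_axioms_def)

lemma (in group) right_translations_iso:
  "(BijGroup (carrier G))\<lparr>carrier := right_translation G ` carrier G\<rparr> \<cong> G"
proof -
  have "right_translation G \<in> iso G ((BijGroup (carrier G))\<lparr>carrier := right_translation G ` carrier G\<rparr>)"
    using right_translation_hom right_translation_inj
    by (auto simp: iso_def hom_def bij_betw_def)
  then show ?thesis using iso_sym is_isoI by blast
qed

lemma (in group) right_translations_sharply_transitive:
  "sharply_transitive_on (right_translation G ` carrier G) (carrier G)"
  unfolding sharply_transitive_on_def
proof (intro ballI ex_ex1I)
  fix x y assume xy: "x \<in> carrier G" "y \<in> carrier G"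
  \<comment> \<open>The witness solves \<open>x \<otimes> inv g = y\<close> for
    \<open>g\<close>.\<close>
  then have "right_translation G (inv y \<otimes> x) x = y"
    by (simp add: right_translation_def inv_mult_group m_assoc[symmetric])
  moreover have "inv y \<otimes> x \<in> carrier G" using xy by simp
  ultimately show "\<exists>f. f \<in> right_translation G ` carrier G \<and> f x = y" by blast
next
  fix x y f f' assume xy: "x \<in> carrier G" "y \<in> carrier G"
    and "f \<in> right_translation G ` carrier G \<and> f x = y" "f' \<in> right_translation G ` carrier G \<and> f' x = y"
  then obtain a b where ab: "a \<in> carrier G" "b \<in> carrier G"
      "f = right_translation G a" "f' = right_translation G b" "x \<otimes> inv a = x \<otimes> inv b"
    by (auto simp: right_translation_def)
  then show "f = f'" using xy by (metis inv_closed inv_inv l_cancel)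
qed

section \<open>From invariant edge partitions to regular 1-factorizations\<close>

lemma (in group) one_factorI:
  assumes S: "S \<subseteq> carrier G - {\<one>}" and E: "E \<subseteq> edges (Cay G S)" "partition_on (carrier G) E"
  shows "one_factor \<lparr>verts = carrier G, edges = E\<rparr> (Cay G S)"
proof -
  have "vdegree \<lparr>verts = carrier G, edges = E\<rparr> v = 1" if "v \<in> carrier G" for v
  proof -
    obtain e where "e \<in> E" "v \<in> e" using partition_onD1[OF E(2)] \<open>v \<in> carrier G\<close> by blast
    then have "{e \<in> E. v \<in> e} = {e}"
      using partition_onD2[OF E(2)] by (auto simp: pairwise_def disjnt_def)
    then show ?thesis by (simp add: vdegree_def)
  qed
  then show ?thesis
    using simple_graph_Cay[OF S] E(1)
    by (auto simp: one_factor_def spanning_subgraph_def simple_graph_def Cay_def)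
qed

lemma (in group) regular_one_factorizationI:
  assumes S: "S \<subseteq> carrier G - {\<one>}" and \<E>: "translation_factorization G S \<E>"
  shows "regular_one_factorization G ((\<lambda>E. \<lparr>verts = carrier G, edges = E\<rparr>) ` \<E>) (Cay G S)"
proof -
  define \<F> where "\<F> = (\<lambda>E. \<lparr>verts = carrier G, edges = E\<rparr>) ` \<E>"
  have part: "partition_on (edges (Cay G S)) \<E>"
    and factor: "\<And>E. E \<in> \<E> \<Longrightarrow> partition_on (carrier G) E"
    and closed: "\<And>E a. \<lbrakk>E \<in> \<E>; a \<in> carrier G\<rbrakk> \<Longrightarrow> (\<lambda>e. e #> a) ` E \<in> \<E>"
    using \<E> by (auto simp: translation_factorization_def)
  have verts: "verts (Cay G S) = carrier G" by (simp add: Cay_def)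
  have "edges ` \<F> = \<E>" by (simp add: \<F>_def image_image)
  moreover have "one_factor F (Cay G S)" if "F \<in> \<F>" for F
    using that one_factorI[OF S] partition_onD1[OF part] factor by (auto simp: \<F>_def)
  ultimately have "one_factorization \<F> (Cay G S)"
    using part by (simp add: one_factorization_def)
  moreover have "graph_image f F \<in> \<F>"
    if "f \<in> right_translation G ` carrier G" "F \<in> \<F>" for f F
  proof -
    obtain a where a: "a \<in> carrier G" "f = right_translation G a" using \<open>f \<in> _\<close> by blast
    obtain E where E: "E \<in> \<E>" "F = \<lparr>verts = carrier G, edges = E\<rparr>"
      using \<open>F \<in> \<F>\<close> unfolding \<F>_def by blast
    \<comment> \<open>By the inverse in \<open>right_translation\<close>, \<open>f\<close> acts on
      edges as translation by \<open>inv a\<close>; closure of the family is therefore applied to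
      \<open>inv a\<close>.\<close>
    have "f ` e = e #> inv a" if "e \<in> E" for e
      using partition_onD1[OF factor[OF E(1)]] that a
      by (auto simp: right_translation_def r_coset_def)
    then have "(\<lambda>e. f ` e) ` E = (\<lambda>e. e #> inv a) ` E" by (intro image_cong) auto
    moreover have "f ` carrier G = carrier G"
      using right_translation_Bij[OF a(1)] a(2) by (auto simp: Bij_def bij_betw_def)
    ultimately show ?thesis
      using closed[OF E(1), of "inv a"] a(1) E(2) by (auto simp: graph_image_def \<F>_def)
  qed
  ultimately show ?thesis
    using right_translations_subgroup right_translations_iso right_translations_sharply_transitive
    unfolding regular_one_factorization_def automorphism_group_of_def verts \<F>_def[symmetric] by blast
qed

section \<open>Combining involutions with the remaining labels\<close>

theorem theorem3p1:
  fixes G (structure) and S :: "'a set"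
  assumes "group G"
    and "infinite (carrier G)"
    and "S \<subseteq> carrier G - {\<one>}"
    and "S = m_inv G ` S"
    and "S - involutions G = {} \<or> S - involutions G \<approx> carrier G"
  shows "\<exists>\<F>. regular_one_factorization G \<F> (Cay G S)"
proof -
  interpret group G by fact
  define T where "T = S - involutions G"
  define I where "I = S \<inter> involutions G"
  have T: "T \<subseteq> carrier G" using assms(3) by (auto simp: T_def)
  have noninv: "s \<otimes> s \<noteq> \<one>" if "s \<in> T" for s
    using that assms(3) involutions_iff by (auto simp: T_def)
  \<comment> \<open>Inversion preserves both \<open>S\<close> and the order of an element.\<close>
  have inv_T: "inv s \<in> T" if "s \<in> T" for s
  proof -
    have s: "s \<in> carrier G" "s \<in> S" "inv s \<in> S" using that assms(3,4) by (auto simp: T_def)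
    have "inv s \<notin> involutions G"
      using that s ord_inv by (auto simp: T_def involutions_def)
    then show ?thesis using s by (simp add: T_def)
  qed
  have "\<exists>\<E>. translation_factorization G T \<E>"
  proof (cases "T = {}")
    case True
    then show ?thesis using translation_factorization_empty by blast
  next
    case False
    then have "T \<approx> carrier G" using assms(5) by (simp add: T_def)
    from exists_starter[OF assms(2) T inv_T this] obtain M where
      "partition_on (carrier G) M"
      "\<And>e. e \<in> M \<Longrightarrow> \<exists>x\<in>carrier G. \<exists>s\<in>T. e = {x, s \<otimes> x}"
      "\<And>s. s \<in> T \<Longrightarrow> \<exists>!e. e \<in> M \<and> (\<exists>x\<in>carrier G. e = {x, s \<otimes> x})"
      by blast
    from translation_factorization_starter[OF T noninv this] show ?thesis by blast
  qed
  then obtain \<E> where "translation_factorization G T \<E>" ..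
  moreover have "translation_factorization G I ((\<lambda>t. {{x, t \<otimes> x} | x. x \<in> carrier G}) ` I)"
    by (rule translation_factorization_involutions) (simp add: I_def)
  \<comment> \<open>The labels of an edge are mutually inverse and \<open>T\<close> is closed under
    inverses, so no edge has labels in both \<open>T\<close> and \<open>I\<close>.\<close>
  moreover have "edges (Cay G T) \<inter> edges (Cay G I) = {}"
  proof -
    have False if e: "e \<in> edges (Cay G T)" "e \<in> edges (Cay G I)" for e
    proof -
      have I: "I \<subseteq> carrier G" using assms(3) by (auto simp: I_def)
      obtain x s y t where "x \<in> carrier G" "s \<in> T" "y \<in> carrier G" "t \<in> I" "{x, s \<otimes> x} = {y, t \<otimes> y}"
        using e by (auto simp: edges_Cay[OF T] edges_Cay[OF I])
      then have "t = s \<or> t = inv s" using edge_label_unique[of x y s t] T I by blast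
      then have "t \<in> T" using inv_T \<open>s \<in> T\<close> by blast
      then show False using \<open>t \<in> I\<close> by (simp add: T_def I_def)
    qed
    then show ?thesis by blast
  qed
  ultimately obtain \<E>' where "translation_factorization G (T \<union> I) \<E>'"
    using translation_factorization_Un by blast
  moreover have "T \<union> I = S" by (auto simp: T_def I_def)
  ultimately show ?thesis using regular_one_factorizationI[OF assms(3)] by metis
qed

end
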